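(* Let $\mathscr{A}$ be a (locally small, well-powered and well-copowered) locally finite category admitting a proper factorisation system $(\mathscr{Q},\mathscr{M})$ such that $\mathscr{A}$ is $\mathscr{Q}$-well-founded. Then $\mathscr{A}$ is right-combinatorial; that is, for all objects $a,b\in\mathscr{A}$, one has $a\cong b$ if and only if for every object $c\in\mathscr{A}$ there is a bijection $\hom_{\mathscr{A}}(c,a)\cong\hom_{\mathscr{A}}(c,b)$.
   Context: A category $\mathscr{A}$ is locally finite if $\hom_{\mathscr{A}}(a,b)$ is a finite set for all objects $a,b$. A proper factorisation system on $\mathscr{A}$ is a pair $(\mathscr{Q},\mathscr{M})$ of classes of morphisms such that: every morphism $f$ factors as $f=m\circ e$ with $e\in\mathscr{Q}$, $m\in\mathscr{M}$; $\mathscr{Q}$ is exactly the class of morphisms with the left lifting property with respect to all morphisms of $\mathscr{M}$, and $\mathscr{M}$ is exactly the class of morphisms with the right lifting property with respect to all morphisms of $\mathscr{Q}$ (fillers not required to be unique); every morphism in $\mathscr{Q}$ is an epimorphism and every morphism in $\mathscr{M}$ is a monomorphism. Morphisms in $\mathscr{Q}$ are called quotients. For an object $a$, $\mathscr{Q}(a)$ is the poset of quotients with domain $a$, where $f\leq g$ iff $f=h\circ g$ for some morphism $h$, modulo the equivalence relation identifying $f$ and $g$ when $f\leq g$ and $g\leq f$. $\mathscr{A}$ is $\mathscr{Q}$-well-founded if for every object $a$ each non-empty subset of $\mathscr{Q}(a)$ has a minimal element. *)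

theory Defs
  imports Main "HOL-Library.Equipollence"
begin

record ('o, 'm) precategory =
  Obj :: "'o set"
  Arr :: "'m set"
  Dom :: "'m \<Rightarrow> 'o"
  Cod :: "'m \<Rightarrow> 'o"
  Ident :: "'o \<Rightarrow> 'm"
  Comp :: "'m \<Rightarrow> 'm \<Rightarrow> 'm"  (infixr "\<cdot>\<index>" 70)

definition hom :: "('o, 'm, 'z) precategory_scheme \<Rightarrow> 'o \<Rightarrow> 'o \<Rightarrow> 'm set" where
  "hom C a b = {f \<in> Arr C. Dom C f = a \<and> Cod C f = b}"

text \<open>
  Composition is written in function order: \<open>g \<cdot> f\<close> is \<open>f\<close> followed by \<open>g\<close>. It is a total
  function of HOL, constrained only on composable pairs of arrows.
\<close>

locale category =
  fixes C :: "('o, 'm, 'z) precategory_scheme" (structure)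
  assumes Dom_in_Obj: "f \<in> Arr C \<Longrightarrow> Dom C f \<in> Obj C"
    and Cod_in_Obj: "f \<in> Arr C \<Longrightarrow> Cod C f \<in> Obj C"
    and Ident_in_hom: "a \<in> Obj C \<Longrightarrow> Ident C a \<in> hom C a a"
    and Comp_in_hom: "f \<in> hom C a b \<Longrightarrow> g \<in> hom C b c \<Longrightarrow> g \<cdot> f \<in> hom C a c"
    and Comp_Ident: "f \<in> hom C a b \<Longrightarrow> f \<cdot> Ident C a = f"
    and Ident_Comp: "f \<in> hom C a b \<Longrightarrow> Ident C b \<cdot> f = f"
    and Comp_assoc:
      "f \<in> hom C a b \<Longrightarrow> g \<in> hom C b c \<Longrightarrow> h \<in> hom C c d \<Longrightarrow> (h \<cdot> g) \<cdot> f = h \<cdot> (g \<cdot> f)"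

definition isomorphic :: "('o, 'm, 'z) precategory_scheme \<Rightarrow> 'o \<Rightarrow> 'o \<Rightarrow> bool" where
  "isomorphic C a b \<longleftrightarrow>
    (\<exists>f \<in> hom C a b. \<exists>g \<in> hom C b a. g \<cdot>\<^bsub>C\<^esub> f = Ident C a \<and> f \<cdot>\<^bsub>C\<^esub> g = Ident C b)"

definition monomorphisms :: "('o, 'm, 'z) precategory_scheme \<Rightarrow> 'm set" where
  "monomorphisms C = {m \<in> Arr C. \<forall>c \<in> Obj C. \<forall>f \<in> hom C c (Dom C m). \<forall>g \<in> hom C c (Dom C m).
     m \<cdot>\<^bsub>C\<^esub> f = m \<cdot>\<^bsub>C\<^esub> g \<longrightarrow> f = g}"

definition epimorphisms :: "('o, 'm, 'z) precategory_scheme \<Rightarrow> 'm set" where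
  "epimorphisms C = {e \<in> Arr C. \<forall>c \<in> Obj C. \<forall>f \<in> hom C (Cod C e) c. \<forall>g \<in> hom C (Cod C e) c.
     f \<cdot>\<^bsub>C\<^esub> e = g \<cdot>\<^bsub>C\<^esub> e \<longrightarrow> f = g}"

definition locally_finite :: "('o, 'm, 'z) precategory_scheme \<Rightarrow> bool" where
  "locally_finite C \<longleftrightarrow> (\<forall>a \<in> Obj C. \<forall>b \<in> Obj C. finite (hom C a b))"

text \<open>
  \<open>lifts C e m\<close>: every commutative square \<open>m \<cdot> u = v \<cdot> e\<close> has a (not necessarily unique)
  diagonal filler.
\<close>

definition lifts :: "('o, 'm, 'z) precategory_scheme \<Rightarrow> 'm \<Rightarrow> 'm \<Rightarrow> bool" where
  "lifts C e m \<longleftrightarrow>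
    (\<forall>u \<in> hom C (Dom C e) (Dom C m). \<forall>v \<in> hom C (Cod C e) (Cod C m).
      m \<cdot>\<^bsub>C\<^esub> u = v \<cdot>\<^bsub>C\<^esub> e \<longrightarrow>
      (\<exists>d \<in> hom C (Cod C e) (Dom C m). d \<cdot>\<^bsub>C\<^esub> e = u \<and> m \<cdot>\<^bsub>C\<^esub> d = v))"

definition proper_factorisation_system ::
    "('o, 'm, 'z) precategory_scheme \<Rightarrow> 'm set \<Rightarrow> 'm set \<Rightarrow> bool" where
  "proper_factorisation_system C Q M \<longleftrightarrow>
    (\<forall>f \<in> Arr C. \<exists>e \<in> Q. \<exists>m \<in> M.
       Dom C e = Dom C f \<and> Cod C e = Dom C m \<and> Cod C m = Cod C f \<and> f = m \<cdot>\<^bsub>C\<^esub> e) \<and>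
    Q = {e \<in> Arr C. \<forall>m \<in> M. lifts C e m} \<and>
    M = {m \<in> Arr C. \<forall>e \<in> Q. lifts C e m} \<and>
    Q \<subseteq> epimorphisms C \<and>
    M \<subseteq> monomorphisms C"

definition quotient_le :: "('o, 'm, 'z) precategory_scheme \<Rightarrow> 'm \<Rightarrow> 'm \<Rightarrow> bool" where
  "quotient_le C f g \<longleftrightarrow> (\<exists>h \<in> hom C (Cod C g) (Cod C f). f = h \<cdot>\<^bsub>C\<^esub> g)"

text \<open>
  The underlying set of the poset of \<open>Q\<close>-quotients of \<open>a\<close> consists of the classes of arrows of
  \<open>Q\<close> with domain \<open>a\<close>, taken modulo the equivalence induced by the preorder \<open>quotient_le\<close>.
\<close>

definition quotients :: "('o, 'm, 'z) precategory_scheme \<Rightarrow> 'm set \<Rightarrow> 'o \<Rightarrow> 'm set set" where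
  "quotients C Q a =
    {f \<in> Q. Dom C f = a} //
    {(f, g). f \<in> Q \<and> g \<in> Q \<and> Dom C f = a \<and> Dom C g = a \<and> quotient_le C f g \<and> quotient_le C g f}"

definition quotient_class_le :: "('o, 'm, 'z) precategory_scheme \<Rightarrow> 'm set \<Rightarrow> 'm set \<Rightarrow> bool" where
  "quotient_class_le C X Y \<longleftrightarrow> (\<exists>f \<in> X. \<exists>g \<in> Y. quotient_le C f g)"

definition quotient_well_founded :: "('o, 'm, 'z) precategory_scheme \<Rightarrow> 'm set \<Rightarrow> bool" where
  "quotient_well_founded C Q \<longleftrightarrow>
    (\<forall>a \<in> Obj C. \<forall>S. S \<subseteq> quotients C Q a \<and> S \<noteq> {} \<longrightarrow>
      (\<exists>X \<in> S. \<forall>Y \<in> S. quotient_class_le C Y X \<longrightarrow> Y = X))"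

definition subobject_le :: "('o, 'm, 'z) precategory_scheme \<Rightarrow> 'm \<Rightarrow> 'm \<Rightarrow> bool" where
  "subobject_le C f g \<longleftrightarrow> (\<exists>h \<in> hom C (Dom C f) (Dom C g). f = g \<cdot>\<^bsub>C\<^esub> h)"

definition subobjects :: "('o, 'm, 'z) precategory_scheme \<Rightarrow> 'o \<Rightarrow> 'm set set" where
  "subobjects C a =
    {f \<in> monomorphisms C. Cod C f = a} //
    {(f, g). f \<in> monomorphisms C \<and> g \<in> monomorphisms C \<and> Cod C f = a \<and> Cod C g = a \<and>
       subobject_le C f g \<and> subobject_le C g f}"

text \<open>
  HOL does not distinguish sets from proper classes. Size conditions are therefore read relative
  to a type \<open>'u\<close> playing the role of the universe: a collection is small if it embeds into \<open>'u\<close>.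
\<close>

definition small :: "'u itself \<Rightarrow> 'a set \<Rightarrow> bool" where
  "small U S \<longleftrightarrow> S \<lesssim> (UNIV :: 'u set)"

definition locally_small :: "'u itself \<Rightarrow> ('o, 'm, 'z) precategory_scheme \<Rightarrow> bool" where
  "locally_small U C \<longleftrightarrow> (\<forall>a \<in> Obj C. \<forall>b \<in> Obj C. small U (hom C a b))"

definition well_powered :: "'u itself \<Rightarrow> ('o, 'm, 'z) precategory_scheme \<Rightarrow> bool" where
  "well_powered U C \<longleftrightarrow> (\<forall>a \<in> Obj C. small U (subobjects C a))"

definition well_copowered :: "'u itself \<Rightarrow> ('o, 'm, 'z) precategory_scheme \<Rightarrow> bool" where
  "well_copowered U C \<longleftrightarrow> (\<forall>a \<in> Obj C. small U (quotients C (epimorphisms C) a))"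

definition right_combinatorial :: "('o, 'm, 'z) precategory_scheme \<Rightarrow> bool" where
  "right_combinatorial C \<longleftrightarrow>
    (\<forall>a \<in> Obj C. \<forall>b \<in> Obj C.
      isomorphic C a b \<longleftrightarrow> (\<forall>c \<in> Obj C. \<exists>\<phi>. bij_betw \<phi> (hom C c a) (hom C c b)))"

end

theory Submission imports Defs begin

text \<open>
  Write \<open>M(c, a)\<close> for the arrows of \<open>M\<close> from \<open>c\<close> to \<open>a\<close>. Factoring an arrow \<open>d \<rightarrow> a\<close> through its
  image shows that the arrows outside \<open>M(d, a)\<close> are the disjoint union of the sets \<open>M(cod r, a)\<close>
  over the non-invertible quotients \<open>r\<close> of \<open>d\<close>, up to equivalence. If \<open>a\<close> and \<open>b\<close> receive equally
  many arrows from every object, then well-founded induction over the quotients \<open>q : c \<rightarrow> d\<close> of a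
  fixed object \<open>c\<close>, with cancellation of finite cardinals in \<open>hom(d, a) \<approx> hom(d, b)\<close>, yields
  \<open>M(d, a) \<approx> M(d, b)\<close>: for a non-invertible quotient \<open>r\<close> of \<open>d\<close>, the quotient \<open>r \<cdot> q\<close> is strictly
  below \<open>q\<close>. As \<open>M\<close> contains the identities, there are monomorphisms \<open>a \<rightarrow> b\<close> and \<open>b \<rightarrow> a\<close>, and
  finiteness of \<open>hom(a, a)\<close> makes \<open>a\<close> and \<open>b\<close> isomorphic.
\<close>

context category
begin

section \<open>Cancellation, lifting squares and isomorphisms in a category\<close>

lemma homD:
  assumes "f \<in> hom C a b"
  shows "f \<in> Arr C" "Dom C f = a" "Cod C f = b" "a \<in> Obj C" "b \<in> Obj C"
  using assms Dom_in_Obj Cod_in_Obj by (auto simp: hom_def)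

lemma Arr_in_hom: "f \<in> Arr C \<Longrightarrow> f \<in> hom C (Dom C f) (Cod C f)"
  by (simp add: hom_def)

lemma monoD:
  assumes "m \<in> monomorphisms C" "m \<in> hom C a b" "f \<in> hom C c a" "g \<in> hom C c a" "m \<cdot> f = m \<cdot> g"
  shows "f = g"
  using assms homD[OF assms(2)] homD[OF assms(3)] unfolding monomorphisms_def by blast

lemma epiD:
  assumes "e \<in> epimorphisms C" "e \<in> hom C a b" "f \<in> hom C b c" "g \<in> hom C b c" "f \<cdot> e = g \<cdot> e"
  shows "f = g"
  using assms homD[OF assms(2)] homD[OF assms(3)] unfolding epimorphisms_def by blast

lemma liftsI:
  assumes "e \<in> hom C a b" "m \<in> hom C c d"
    and "\<And>u v. \<lbrakk>u \<in> hom C a c; v \<in> hom C b d; m \<cdot> u = v \<cdot> e\<rbrakk>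
      \<Longrightarrow> \<exists>w \<in> hom C b c. w \<cdot> e = u \<and> m \<cdot> w = v"
  shows "lifts C e m"
  using assms homD[OF assms(1)] homD[OF assms(2)] unfolding lifts_def by auto

lemma liftsE:
  assumes "lifts C e m" "e \<in> hom C a b" "m \<in> hom C c d"
    and "u \<in> hom C a c" "v \<in> hom C b d" "m \<cdot> u = v \<cdot> e"
  obtains w where "w \<in> hom C b c" "w \<cdot> e = u" "m \<cdot> w = v"
  using assms homD[OF assms(2)] homD[OF assms(3)] unfolding lifts_def by auto

text \<open>Both \<open>n \<cdot> (s \<cdot> n)\<close> and \<open>n \<cdot> Ident C b\<close> equal
  \<open>n\<close>; cancelling the monomorphism \<open>n\<close> makes \<open>s\<close> a two-sided
  inverse.\<close>

lemma split_epi_mono_imp_isomorphic: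
  assumes n: "n \<in> hom C b a" and mono: "n \<in> monomorphisms C"
    and s: "s \<in> hom C a b" and ns: "n \<cdot> s = Ident C a"
  shows "isomorphic C a b"
proof -
  have "n \<cdot> (s \<cdot> n) = n \<cdot> Ident C b"
    using n s ns by (metis Comp_Ident Ident_Comp Comp_assoc)
  then have "s \<cdot> n = Ident C b"
    using monoD[OF mono n] n s Comp_in_hom Ident_in_hom homD by metis
  then show ?thesis
    unfolding isomorphic_def using n s ns by auto
qed

text \<open>Composing with \<open>m\<close> and then \<open>n\<close> is an injective self-map of
  the finite set \<open>hom C a a\<close>, hence surjective. A preimage \<open>x\<close> of the
  identity makes \<open>m \<cdot> x\<close> a section of \<open>n\<close>.\<close>

lemma mutual_monos_imp_isomorphic:
  assumes m: "m \<in> hom C a b" "m \<in> monomorphisms C"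
    and n: "n \<in> hom C b a" "n \<in> monomorphisms C"
    and fin: "finite (hom C a a)"
  shows "isomorphic C a b"
proof -
  let ?F = "\<lambda>x. n \<cdot> (m \<cdot> x)"
  have "inj_on ?F (hom C a a)"
  proof (rule inj_onI)
    fix x y assume xy: "x \<in> hom C a a" "y \<in> hom C a a" and eq: "?F x = ?F y"
    have "m \<cdot> x = m \<cdot> y"
      using monoD[OF n(2,1) _ _ eq] xy m Comp_in_hom by blast
    then show "x = y"
      using monoD[OF m(2,1)] xy by blast
  qed
  moreover have "?F ` hom C a a \<subseteq> hom C a a"
    using m n Comp_in_hom by blast
  ultimately have "?F ` hom C a a = hom C a a"
    using fin by (simp add: endo_inj_surj)
  moreover have "Ident C a \<in> hom C a a"
    using Ident_in_hom homD(4)[OF m(1)] by blast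
  ultimately obtain x where "x \<in> hom C a a" "n \<cdot> (m \<cdot> x) = Ident C a"
    by (metis (no_types, lifting) imageE)
  then show ?thesis
    using split_epi_mono_imp_isomorphic[OF n, of "m \<cdot> x"] m Comp_in_hom by blast
qed

lemma isomorphic_imp_bij_betw_hom:
  assumes "isomorphic C a b"
  shows "\<exists>\<phi>. bij_betw \<phi> (hom C c a) (hom C c b)"
proof -
  obtain f g where f: "f \<in> hom C a b" and g: "g \<in> hom C b a"
    and gf: "g \<cdot> f = Ident C a" and fg: "f \<cdot> g = Ident C b"
    using assms unfolding isomorphic_def by auto
  have "bij_betw (\<lambda>x. f \<cdot> x) (hom C c a) (hom C c b)"
  proof (rule bij_betwI[where g = "\<lambda>y. g \<cdot> y"])
    show "g \<cdot> (f \<cdot> x) = x" if "x \<in> hom C c a" for x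
      using Comp_assoc[OF that f g] gf Ident_Comp[OF that] by simp
    show "f \<cdot> (g \<cdot> y) = y" if "y \<in> hom C c b" for y
      using Comp_assoc[OF that g f] fg Ident_Comp[OF that] by simp
  qed (use f g Comp_in_hom in blast)+
  then show ?thesis by blast
qed

section \<open>The preorder on arrows with a common domain\<close>

lemma quotient_leI: "f = h \<cdot> g \<Longrightarrow> f \<in> hom C a b \<Longrightarrow> g \<in> hom C a c \<Longrightarrow> h \<in> hom C c b \<Longrightarrow> quotient_le C f g"
  unfolding quotient_le_def using homD by metis

lemma quotient_leE:
  assumes "quotient_le C f g" "f \<in> hom C a b" "g \<in> hom C a c"
  obtains h where "h \<in> hom C c b" "f = h \<cdot> g"
  using assms homD[OF assms(2)] homD[OF assms(3)] unfolding quotient_le_def by auto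

lemma quotient_le_refl:
  assumes "f \<in> Arr C"
  shows "quotient_le C f f"
  using assms Arr_in_hom Ident_Comp Ident_in_hom Cod_in_Obj quotient_leI by metis

lemma quotient_le_trans:
  assumes fg: "quotient_le C f g" and gh: "quotient_le C g h"
    and f: "f \<in> hom C a b" and g: "g \<in> hom C a c" and h: "h \<in> hom C a d"
  shows "quotient_le C f h"
proof -
  obtain k where k: "k \<in> hom C c b" "f = k \<cdot> g"
    using quotient_leE[OF fg f g] .
  obtain l where l: "l \<in> hom C d c" "g = l \<cdot> h"
    using quotient_leE[OF gh g h] .
  have "f = (k \<cdot> l) \<cdot> h"
    using Comp_assoc[OF h l(1) k(1)] k l by simp
  then show ?thesis
    using quotient_leI f h Comp_in_hom[OF l(1) k(1)] by blast
qed

end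

section \<open>Closure properties of the two classes of a proper factorisation system\<close>

locale proper_factorisation = category +
  fixes Q M :: "'b set"
  assumes factorisation: "proper_factorisation_system C Q M"
begin

lemma Q_Arr: "e \<in> Q \<Longrightarrow> e \<in> Arr C" and M_Arr: "m \<in> M \<Longrightarrow> m \<in> Arr C"
  and Q_lifts_M: "e \<in> Q \<Longrightarrow> m \<in> M \<Longrightarrow> lifts C e m"
  and Q_epi: "e \<in> Q \<Longrightarrow> e \<in> epimorphisms C"
  and M_mono: "m \<in> M \<Longrightarrow> m \<in> monomorphisms C"
  using factorisation unfolding proper_factorisation_system_def by blast+

lemma in_QI: "e \<in> Arr C \<Longrightarrow> (\<And>m. m \<in> M \<Longrightarrow> lifts C e m) \<Longrightarrow> e \<in> Q"
  using factorisation unfolding proper_factorisation_system_def by blast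

lemma in_MI: "m \<in> Arr C \<Longrightarrow> (\<And>e. e \<in> Q \<Longrightarrow> lifts C e m) \<Longrightarrow> m \<in> M"
  using factorisation unfolding proper_factorisation_system_def by blast

lemma factor:
  assumes "f \<in> hom C a b"
  obtains e m c where "e \<in> Q" "m \<in> M" "e \<in> hom C a c" "m \<in> hom C c b" "f = m \<cdot> e"
proof -
  obtain e m where em: "e \<in> Q" "m \<in> M" "Dom C e = Dom C f" "Cod C e = Dom C m"
    "Cod C m = Cod C f" "f = m \<cdot> e"
    using factorisation homD(1)[OF assms] unfolding proper_factorisation_system_def by blast
  then show thesis
    using that[of e m "Dom C m"] Q_Arr M_Arr homD[OF assms] by (simp add: hom_def)
qed

text \<open>A square is filled in two stages: first against \<open>q\<close>, with
  \<open>v \<cdot> r\<close> as the edge opposite \<open>u\<close>, and then against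
  \<open>r\<close>, with the first filler \<open>w\<close> in place of \<open>u\<close>.\<close>

lemma Q_Comp:
  assumes q: "q \<in> Q" "q \<in> hom C a b" and r: "r \<in> Q" "r \<in> hom C b c"
  shows "r \<cdot> q \<in> Q"
proof (rule in_QI)
  have rq: "r \<cdot> q \<in> hom C a c"
    using Comp_in_hom q r by blast
  then show "r \<cdot> q \<in> Arr C"
    by (rule homD)
  fix m assume m: "m \<in> M"
  let ?s = "Dom C m" and ?t = "Cod C m"
  have mh: "m \<in> hom C ?s ?t"
    using m M_Arr Arr_in_hom by blast
  show "lifts C (r \<cdot> q) m"
  proof (rule liftsI[OF rq mh])
    fix u v assume u: "u \<in> hom C a ?s" and v: "v \<in> hom C c ?t" and sq: "m \<cdot> u = v \<cdot> (r \<cdot> q)"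
    have "m \<cdot> u = (v \<cdot> r) \<cdot> q"
      using sq Comp_assoc[OF q(2) r(2) v] by simp
    then obtain w where w: "w \<in> hom C b ?s" "w \<cdot> q = u" "m \<cdot> w = v \<cdot> r"
      using liftsE[OF Q_lifts_M[OF q(1) m] q(2) mh u Comp_in_hom[OF r(2) v]] by blast
    obtain z where z: "z \<in> hom C c ?s" "z \<cdot> r = w" "m \<cdot> z = v"
      using liftsE[OF Q_lifts_M[OF r(1) m] r(2) mh w(1) v w(3)] by blast
    show "\<exists>z \<in> hom C c ?s. z \<cdot> (r \<cdot> q) = u \<and> m \<cdot> z = v"
      using z w Comp_assoc[OF q(2) r(2) z(1)] by auto
  qed
qed

text \<open>Dual to \<open>Q_Comp\<close>: lift first along \<open>n\<close>, then lift the
  resulting filler along \<open>m\<close>.\<close>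

lemma M_Comp:
  assumes m: "m \<in> M" "m \<in> hom C a b" and n: "n \<in> M" "n \<in> hom C b c"
  shows "n \<cdot> m \<in> M"
proof (rule in_MI)
  have nm: "n \<cdot> m \<in> hom C a c"
    using Comp_in_hom m n by blast
  then show "n \<cdot> m \<in> Arr C"
    by (rule homD)
  fix e assume e: "e \<in> Q"
  let ?s = "Dom C e" and ?t = "Cod C e"
  have eh: "e \<in> hom C ?s ?t"
    using e Q_Arr Arr_in_hom by blast
  show "lifts C e (n \<cdot> m)"
  proof (rule liftsI[OF eh nm])
    fix u v assume u: "u \<in> hom C ?s a" and v: "v \<in> hom C ?t c" and sq: "(n \<cdot> m) \<cdot> u = v \<cdot> e"
    have "n \<cdot> (m \<cdot> u) = v \<cdot> e"
      using sq Comp_assoc[OF u m(2) n(2)] by simp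
    then obtain w where w: "w \<in> hom C ?t b" "w \<cdot> e = m \<cdot> u" "n \<cdot> w = v"
      using liftsE[OF Q_lifts_M[OF e n(1)] eh n(2) Comp_in_hom[OF u m(2)] v] by blast
    obtain z where z: "z \<in> hom C ?t a" "z \<cdot> e = u" "m \<cdot> z = w"
      using liftsE[OF Q_lifts_M[OF e m(1)] eh m(2) u w(1) w(2)[symmetric]] by blast
    show "\<exists>z \<in> hom C ?t a. z \<cdot> e = u \<and> (n \<cdot> m) \<cdot> z = v"
      using z w Comp_assoc[OF z(1) m(2) n(2)] by auto
  qed
qed

text \<open>Inverting \<open>h\<close> fills every square, with diagonal
  \<open>k \<cdot> v\<close>.\<close>

lemma iso_in_M:
  assumes h: "h \<in> hom C a b" and k: "k \<in> hom C b a"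
    and kh: "k \<cdot> h = Ident C a" and hk: "h \<cdot> k = Ident C b"
  shows "h \<in> M"
proof (rule in_MI)
  show "h \<in> Arr C"
    using h by (rule homD)
  fix e assume e: "e \<in> Q"
  let ?s = "Dom C e" and ?t = "Cod C e"
  have eh: "e \<in> hom C ?s ?t"
    using e Q_Arr Arr_in_hom by blast
  show "lifts C e h"
  proof (rule liftsI[OF eh h])
    fix u v assume u: "u \<in> hom C ?s a" and v: "v \<in> hom C ?t b" and sq: "h \<cdot> u = v \<cdot> e"
    have "(k \<cdot> v) \<cdot> e = u"
      using Comp_assoc[OF eh v k] Comp_assoc[OF u h k] sq kh Ident_Comp[OF u] by simp
    moreover have "h \<cdot> (k \<cdot> v) = v"
      using Comp_assoc[OF v k h] hk Ident_Comp[OF v] by simp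
    ultimately show "\<exists>w \<in> hom C ?t a. w \<cdot> e = u \<and> h \<cdot> w = v"
      using Comp_in_hom[OF v k] by blast
  qed
qed

lemma Ident_in_Q:
  assumes "a \<in> Obj C"
  shows "Ident C a \<in> Q"
proof (rule in_QI)
  have i: "Ident C a \<in> hom C a a"
    using assms by (rule Ident_in_hom)
  then show "Ident C a \<in> Arr C"
    by (rule homD)
  fix m assume "m \<in> M"
  then have m: "m \<in> hom C (Dom C m) (Cod C m)"
    using M_Arr Arr_in_hom by blast
  \<comment> \<open>The edge \<open>u\<close> itself is the filler.\<close>
  show "lifts C (Ident C a) m"
    using liftsI[OF i m] Comp_Ident by metis
qed

lemma Ident_in_M: "a \<in> Obj C \<Longrightarrow> Ident C a \<in> M"
  using iso_in_M Ident_in_hom Comp_Ident by metis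

text \<open>The two comparison arrows are mutually inverse because \<open>e\<close> and
  \<open>r\<close> are epimorphisms, so they are isomorphisms and \<open>iso_in_M\<close> applies.
  This allows a quotient to be exchanged for an equivalent one at the cost of a factor in
  \<open>M\<close>.\<close>

lemma equivalent_quotients_in_M:
  assumes e: "e \<in> Q" "e \<in> hom C a b" and r: "r \<in> Q" "r \<in> hom C a c"
    and er: "quotient_le C e r" "quotient_le C r e"
  obtains h where "h \<in> M" "h \<in> hom C c b" "e = h \<cdot> r"
proof -
  obtain h where h: "h \<in> hom C c b" "e = h \<cdot> r"
    using quotient_leE[OF er(1) e(2) r(2)] .
  obtain k where k: "k \<in> hom C b c" "r = k \<cdot> e"
    using quotient_leE[OF er(2) r(2) e(2)] .
  have "(h \<cdot> k) \<cdot> e = Ident C b \<cdot> e"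
    using Comp_assoc[OF e(2) k(1) h(1)] h(2)[symmetric] k(2)[symmetric] Ident_Comp[OF e(2)] by simp
  then have hk: "h \<cdot> k = Ident C b"
    using epiD[OF Q_epi[OF e(1)] e(2)] Comp_in_hom[OF k(1) h(1)] Ident_in_hom homD(4)[OF k(1)] by blast
  have "(k \<cdot> h) \<cdot> r = Ident C c \<cdot> r"
    using Comp_assoc[OF r(2) h(1) k(1)] h(2)[symmetric] k(2)[symmetric] Ident_Comp[OF r(2)] by simp
  then have kh: "k \<cdot> h = Ident C c"
    using epiD[OF Q_epi[OF r(1)] r(2)] Comp_in_hom[OF h(1) k(1)] Ident_in_hom homD(4)[OF h(1)] by blast
  show thesis
    using that iso_in_M[OF h(1) k(1) kh hk] h by blast
qed

section \<open>Chosen representatives of quotients and the decomposition of hom-sets\<close>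

definition Mhom :: "'a \<Rightarrow> 'a \<Rightarrow> 'b set" where
  "Mhom a b = hom C a b \<inter> M"

text \<open>The relation that \<open>quotients\<close> divides by, taken over all domains at
  once.\<close>

definition equivalent_quotients :: "'b \<Rightarrow> 'b \<Rightarrow> bool" where
  "equivalent_quotients f g \<longleftrightarrow> f \<in> Q \<and> g \<in> Q \<and> Dom C f = Dom C g \<and>
    quotient_le C f g \<and> quotient_le C g f"

lemma equivalent_quotients_refl: "f \<in> Q \<Longrightarrow> equivalent_quotients f f"
  unfolding equivalent_quotients_def using quotient_le_refl Q_Arr by blast

lemma equivalent_quotients_sym: "equivalent_quotients f g \<Longrightarrow> equivalent_quotients g f"
  unfolding equivalent_quotients_def by auto

lemma equivalent_quotients_trans:
  "equivalent_quotients f g \<Longrightarrow> equivalent_quotients g h \<Longrightarrow> equivalent_quotients f h"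
  unfolding equivalent_quotients_def using quotient_le_trans Q_Arr Arr_in_hom by metis

text \<open>The fixed points of this map in \<open>Q\<close> contain exactly one arrow of each
  class, so disjoint unions can be indexed by arrows instead of classes.\<close>

definition representative :: "'b \<Rightarrow> 'b" where
  "representative f = (SOME g. equivalent_quotients f g)"

lemma equivalent_representative: "f \<in> Q \<Longrightarrow> equivalent_quotients f (representative f)"
  unfolding representative_def by (rule someI) (rule equivalent_quotients_refl)

text \<open>Symmetry and transitivity make the two predicates equal as functions, so the choice
  operator picks the same arrow for both.\<close>

lemma representative_cong:
  assumes "equivalent_quotients f g"
  shows "representative f = representative g"
proof -
  have "equivalent_quotients f = equivalent_quotients g"
    using assms equivalent_quotients_sym equivalent_quotients_trans by blast
  then show ?thesis
    unfolding representative_def by simp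
qed

text \<open>A quotient of \<open>d\<close> is non-invertible iff the identity of \<open>d\<close> is not below it.\<close>

definition noninvertible_quotients :: "'a \<Rightarrow> 'b set" where
  "noninvertible_quotients d =
    {r \<in> Q. Dom C r = d \<and> \<not> quotient_le C (Ident C d) r \<and> representative r = r}"

lemma Ident_quotient_leI:
  assumes "r \<in> hom C d c" "h \<in> hom C c d" "h \<cdot> r = Ident C d"
  shows "quotient_le C (Ident C d) r"
  using assms quotient_leI Ident_in_hom homD(4) by metis

text \<open>
  Image factorisations are unique up to isomorphism, so each arrow outside \<open>M\<close> is \<open>m \<cdot> r\<close> for
  exactly one chosen representative \<open>r\<close>.
\<close>

lemma hom_diff_Mhom_eqpoll:
  "hom C d a - Mhom d a \<approx> (SIGMA r : noninvertible_quotients d. Mhom (Cod C r) a)"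
proof -
  let ?S = "SIGMA r : noninvertible_quotients d. Mhom (Cod C r) a"
  let ?F = "\<lambda>(r, m). m \<cdot> r"
  have S: "r \<in> Q" "r \<in> hom C d (Cod C r)" "m \<in> M" "m \<in> hom C (Cod C r) a"
    "\<not> quotient_le C (Ident C d) r" "representative r = r"
    if "(r, m) \<in> ?S" for r m
    using that Q_Arr unfolding noninvertible_quotients_def Mhom_def hom_def by auto
  \<comment> \<open>A diagonal filler of the square \<open>m' \<cdot> r' = m \<cdot> r\<close>
    compares the two factorisations; exchanging their roles gives the other inequality.\<close>
  have le: "quotient_le C r' r" if p: "(r, m) \<in> ?S" and p': "(r', m') \<in> ?S" and eq: "m \<cdot> r = m' \<cdot> r'"
    for r m r' m'
  proof -
    obtain w where "w \<in> hom C (Cod C r) (Cod C r')" "w \<cdot> r = r'"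
      using liftsE[OF Q_lifts_M[OF S(1)[OF p] S(3)[OF p']] S(2)[OF p] S(4)[OF p'] S(2)[OF p']
          S(4)[OF p] eq[symmetric]] .
    then show ?thesis
      using quotient_leI S(2)[OF p] S(2)[OF p'] by blast
  qed
  have inj: "inj_on ?F ?S"
  proof (rule inj_onI, clarify)
    fix r m r' m' assume r: "r \<in> noninvertible_quotients d" and m: "m \<in> Mhom (Cod C r) a"
      and r': "r' \<in> noninvertible_quotients d" and m': "m' \<in> Mhom (Cod C r') a"
      and eq: "m \<cdot> r = m' \<cdot> r'"
    have p: "(r, m) \<in> ?S" and p': "(r', m') \<in> ?S"
      using r m r' m' by auto
    have "equivalent_quotients r r'"
      unfolding equivalent_quotients_def
      using S[OF p] S[OF p'] le[OF p p' eq] le[OF p' p eq[symmetric]] homD(2) by metis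
    then have rr: "r = r'"
      using representative_cong S(6)[OF p] S(6)[OF p'] by metis
    moreover have "m = m'"
      using epiD[OF Q_epi[OF S(1)[OF p]] S(2)[OF p] S(4)[OF p]] S(4)[OF p'] eq rr by metis
    ultimately show "r = r' \<and> m = m'" by simp
  qed
  have "?F ` ?S = hom C d a - Mhom d a"
  proof (intro equalityI subsetI)
    fix f assume "f \<in> ?F ` ?S"
    then obtain r m where p: "(r, m) \<in> ?S" and f: "f = m \<cdot> r"
      by auto
    have fh: "f \<in> hom C d a"
      using f Comp_in_hom S[OF p] by blast
    have d: "d \<in> Obj C"
      using homD(4)[OF fh] .
    \<comment> \<open>If \<open>f\<close> were in \<open>M\<close>, lifting \<open>r\<close> against
      \<open>f\<close> in the square \<open>f \<cdot> Ident C d = m \<cdot> r\<close> would give a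
      left inverse of \<open>r\<close>.\<close>
    have "f \<notin> M"
    proof
      assume "f \<in> M"
      moreover have "f \<cdot> Ident C d = m \<cdot> r"
        using Comp_Ident fh f by simp
      ultimately obtain w where "w \<in> hom C (Cod C r) d" "w \<cdot> r = Ident C d"
        using liftsE[OF Q_lifts_M[OF S(1)[OF p]] S(2)[OF p] fh Ident_in_hom[OF d] S(4)[OF p]] by blast
      then show False
        using Ident_quotient_leI S(2,5)[OF p] by blast
    qed
    then show "f \<in> hom C d a - Mhom d a"
      using fh unfolding Mhom_def by simp
  next
    fix f assume "f \<in> hom C d a - Mhom d a"
    then have fh: "f \<in> hom C d a" and fM: "f \<notin> M"
      unfolding Mhom_def by auto
    have d: "d \<in> Obj C"
      using homD(4)[OF fh] .
    obtain e m c where e: "e \<in> Q" "e \<in> hom C d c" and m: "m \<in> M" "m \<in> hom C c a" and f: "f = m \<cdot> e"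
      using factor[OF fh] by metis
    \<comment> \<open>Otherwise \<open>e\<close> would be equivalent to the identity of
      \<open>d\<close>, hence in \<open>M\<close>, and so would be
      \<open>f = m \<cdot> e\<close>.\<close>
    have e_not: "\<not> quotient_le C (Ident C d) e"
    proof
      assume le: "quotient_le C (Ident C d) e"
      have "quotient_le C e (Ident C d)"
        using quotient_leI Comp_Ident[OF e(2)] Ident_in_hom[OF d] e(2) by metis
      then obtain h where "h \<in> M" "h \<in> hom C d c" "e = h \<cdot> Ident C d"
        using equivalent_quotients_in_M[OF e Ident_in_Q[OF d] Ident_in_hom[OF d] _ le] by blast
      then have "e \<in> M"
        using Comp_Ident by metis
      then show False
        using M_Comp[OF _ e(2) m] f fM by simp
    qed
    \<comment> \<open>The quotient part \<open>e\<close> is replaced by its representative; the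
      comparison arrow \<open>h\<close> is absorbed into \<open>m\<close>.\<close>
    define r where "r = representative e"
    have er: "equivalent_quotients e r"
      unfolding r_def by (rule equivalent_representative[OF e(1)])
    then have r: "r \<in> Q" "r \<in> hom C d (Cod C r)" and le: "quotient_le C e r" "quotient_le C r e"
      unfolding equivalent_quotients_def using Q_Arr Arr_in_hom homD(2)[OF e(2)] by metis+
    have "\<not> quotient_le C (Ident C d) r"
      using quotient_le_trans[OF _ le(2) Ident_in_hom[OF d] r(2) e(2)] e_not by blast
    moreover have "representative r = r"
      using representative_cong[OF er] r_def by simp
    ultimately have rN: "r \<in> noninvertible_quotients d"
      unfolding noninvertible_quotients_def using r homD(2)[OF r(2)] by simp
    obtain h where h: "h \<in> M" "h \<in> hom C (Cod C r) c" "e = h \<cdot> r"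
      using equivalent_quotients_in_M[OF e r le] .
    have "m \<cdot> h \<in> Mhom (Cod C r) a"
      unfolding Mhom_def using M_Comp[OF h(1,2) m] Comp_in_hom[OF h(2) m(2)] by simp
    moreover have "f = (m \<cdot> h) \<cdot> r"
      using Comp_assoc[OF r(2) h(2) m(2)] f h(3) by simp
    ultimately show "f \<in> ?F ` ?S"
      using rN by (intro image_eqI[where x = "(r, m \<cdot> h)"]) auto
  qed
  then have "bij_betw ?F ?S (hom C d a - Mhom d a)"
    using inj by (simp add: bij_betw_def)
  then show ?thesis
    using eqpoll_def eqpoll_sym by blast
qed

section \<open>Well-founded induction over quotients and counting\<close>

text \<open>Transfers well-foundedness from classes to arrows: a minimal class among those of the
  members of \<open>T\<close> yields a member minimal up to equivalence.\<close>

lemma minimal_quotient: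
  assumes wf: "quotient_well_founded C Q" and c: "c \<in> Obj C"
    and T: "T \<subseteq> {q \<in> Q. Dom C q = c}" "T \<noteq> {}"
  obtains q where "q \<in> T" "\<And>q'. q' \<in> T \<Longrightarrow> quotient_le C q' q \<Longrightarrow> quotient_le C q q'"
proof -
  define E where "E = {(f, g). f \<in> Q \<and> g \<in> Q \<and> Dom C f = c \<and> Dom C g = c \<and>
    quotient_le C f g \<and> quotient_le C g f}"
  have self: "q \<in> E `` {q}" if "q \<in> T" for q
    using that T(1) equivalent_quotients_refl unfolding E_def equivalent_quotients_def by auto
  define S where "S = (\<lambda>q. E `` {q}) ` T"
  have "S \<subseteq> quotients C Q c"
    unfolding S_def quotients_def E_def[symmetric] using T(1) by (auto intro: quotientI)
  moreover have "S \<noteq> {}"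
    unfolding S_def using T(2) by simp
  ultimately obtain X where X: "X \<in> S" "\<And>Y. Y \<in> S \<Longrightarrow> quotient_class_le C Y X \<Longrightarrow> Y = X"
    using wf[unfolded quotient_well_founded_def, rule_format, OF c, of S] by blast
  then obtain q where q: "q \<in> T" "X = E `` {q}"
    unfolding S_def by blast
  have "quotient_le C q q'" if q': "q' \<in> T" "quotient_le C q' q" for q'
  proof -
    have "quotient_class_le C (E `` {q'}) (E `` {q})"
      unfolding quotient_class_le_def using self q'(1) q(1) q'(2) by blast
    then have "E `` {q'} = E `` {q}"
      using X(2) q q'(1) unfolding S_def by blast
    then have "(q, q') \<in> E"
      using self[OF q'(1)] by blast
    then show ?thesis
      unfolding E_def by simp
  qed
  then show thesis
    using that q(1) by blast
qed

text \<open>Well-foundedness compares only quotients of one object, so the claim is proved at the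
  codomain of every quotient of \<open>c\<close>; the identity of \<open>c\<close> then gives the
  claim at \<open>c\<close>. The set \<open>T\<close> collects the counterexamples.\<close>

lemma Mhom_eqpoll:
  assumes wf: "quotient_well_founded C Q" and lf: "locally_finite C"
    and a: "a \<in> Obj C" and b: "b \<in> Obj C" and c: "c \<in> Obj C"
    and ab: "\<And>d. d \<in> Obj C \<Longrightarrow> hom C d a \<approx> hom C d b"
  shows "Mhom c a \<approx> Mhom c b"
proof -
  define T where "T = {q \<in> Q. Dom C q = c \<and> \<not> Mhom (Cod C q) a \<approx> Mhom (Cod C q) b}"
  have "T = {}"
  proof (rule ccontr)
    assume "T \<noteq> {}"
    moreover have "T \<subseteq> {q \<in> Q. Dom C q = c}"
      unfolding T_def by auto
    ultimately obtain q where qT: "q \<in> T"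
      and min: "\<And>q'. q' \<in> T \<Longrightarrow> quotient_le C q' q \<Longrightarrow> quotient_le C q q'"
      using minimal_quotient[OF wf c] by metis
    define d where "d = Cod C q"
    have q: "q \<in> Q" "q \<in> hom C c d" and neq: "\<not> Mhom d a \<approx> Mhom d b"
      using qT Q_Arr unfolding T_def d_def hom_def by auto
    have d: "d \<in> Obj C"
      using homD(5)[OF q(2)] .
    have "Mhom (Cod C r) a \<approx> Mhom (Cod C r) b" if rN: "r \<in> noninvertible_quotients d" for r
    proof (rule ccontr)
      assume neq: "\<not> Mhom (Cod C r) a \<approx> Mhom (Cod C r) b"
      have r: "r \<in> Q" "r \<in> hom C d (Cod C r)" "\<not> quotient_le C (Ident C d) r"
        using rN Q_Arr unfolding noninvertible_quotients_def hom_def by auto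
      have rq: "r \<cdot> q \<in> hom C c (Cod C r)"
        using Comp_in_hom q r by blast
      then have "r \<cdot> q \<in> T"
        unfolding T_def using Q_Comp[OF q r(1,2)] neq homD(2,3)[OF rq] by simp
      moreover have "quotient_le C (r \<cdot> q) q"
        using quotient_leI[OF refl rq q(2) r(2)] .
      \<comment> \<open>Minimality of \<open>q\<close> forces this reverse inequality; cancelling
        the epimorphism \<open>q\<close> from it makes \<open>r\<close> left invertible, a
        contradiction.\<close>
      ultimately have "quotient_le C q (r \<cdot> q)"
        by (rule min)
      then obtain h where h: "h \<in> hom C (Cod C r) d" "q = h \<cdot> (r \<cdot> q)"
        using quotient_leE[OF _ q(2) rq] by blast
      have "(h \<cdot> r) \<cdot> q = Ident C d \<cdot> q"
        using Comp_assoc[OF q(2) r(2) h(1)] h(2) Ident_Comp[OF q(2)] by simp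
      then have "h \<cdot> r = Ident C d"
        using epiD[OF Q_epi[OF q(1)] q(2)] Comp_in_hom[OF r(2) h(1)] Ident_in_hom[OF d] by blast
      then show False
        using Ident_quotient_leI r(2,3) h(1) by blast
    qed
    \<comment> \<open>The index set is the same for \<open>a\<close> and \<open>b\<close>, so the
      fibrewise bijections assemble.\<close>
    then have "(SIGMA r : noninvertible_quotients d. Mhom (Cod C r) a) \<approx>
        (SIGMA r : noninvertible_quotients d. Mhom (Cod C r) b)"
      by (intro Sigma_eqpoll_cong[OF bij_betw_id]) auto
    then have "hom C d a - Mhom d a \<approx> hom C d b - Mhom d b"
      using hom_diff_Mhom_eqpoll eqpoll_trans eqpoll_sym by meson
    \<comment> \<open>Finiteness permits subtraction: equal totals and equal numbers of arrows
      outside \<open>M\<close> leave equal numbers inside \<open>M\<close>.\<close>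
    moreover have fin: "finite (hom C d a)" "finite (hom C d b)"
      using lf a b d unfolding locally_finite_def by auto
    ultimately have "card (hom C d a - Mhom d a) = card (hom C d b - Mhom d b)"
      by (simp add: eqpoll_iff_card)
    moreover have "card (hom C d a) = card (hom C d b)"
      using ab[OF d] fin by (simp add: eqpoll_iff_card)
    moreover have "card (hom C d x) = card (Mhom d x) + card (hom C d x - Mhom d x)"
      if "finite (hom C d x)" for x
      using card_Int_Diff[OF that, of "Mhom d x"] by (simp add: Mhom_def)
    ultimately have "card (Mhom d a) = card (Mhom d b)"
      using fin by simp
    then have "Mhom d a \<approx> Mhom d b"
      using fin by (simp add: eqpoll_iff_card Mhom_def)
    then show False
      using neq by simp
  qed
  moreover have "Ident C c \<in> Q" "Ident C c \<in> hom C c c"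
    using Ident_in_Q[OF c] Ident_in_hom[OF c] by auto
  ultimately show ?thesis
    unfolding T_def using homD(2,3)[OF Ident_in_hom[OF c]] by auto
qed

section \<open>From equipollent hom-sets to an isomorphism\<close>

lemma isomorphic_if_hom_eqpoll:
  assumes wf: "quotient_well_founded C Q" and lf: "locally_finite C"
    and a: "a \<in> Obj C" and b: "b \<in> Obj C"
    and ab: "\<And>d. d \<in> Obj C \<Longrightarrow> hom C d a \<approx> hom C d b"
  shows "isomorphic C a b"
proof -
  \<comment> \<open>The identities witness nonemptiness, which the equipollences at \<open>a\<close>
    and \<open>b\<close> carry over to arrows of \<open>M\<close> in both directions.\<close>
  have "Mhom a a \<noteq> {}" "Mhom b b \<noteq> {}"
    using Ident_in_M Ident_in_hom a b unfolding Mhom_def by blast+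
  moreover have "Mhom a a \<approx> Mhom a b" "Mhom b a \<approx> Mhom b b"
    using Mhom_eqpoll[OF wf lf a b _ ab] a b by blast+
  ultimately obtain m n where "m \<in> Mhom a b" "n \<in> Mhom b a"
    by (metis equals0I eqpoll_empty_iff_empty eqpoll_sym)
  then show ?thesis
    using mutual_monos_imp_isomorphic[of m a b n] M_mono lf a
    unfolding Mhom_def locally_finite_def by blast
qed

end

theorem theorem4p3:
  fixes A :: "('o, 'm) precategory"
    and Q M :: "'m set"
  assumes "category A"
    and "locally_small TYPE('u) A"
    and "well_powered TYPE('u) A"
    and "well_copowered TYPE('u) A"
    and "locally_finite A"
    and "proper_factorisation_system A Q M"
    and "quotient_well_founded A Q"
  shows "right_combinatorial A"
proof -
  interpret proper_factorisation A Q M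
    using assms(1,6) by (simp add: proper_factorisation_def proper_factorisation_axioms_def)
  show ?thesis
    unfolding right_combinatorial_def
    using isomorphic_imp_bij_betw_hom isomorphic_if_hom_eqpoll[OF assms(7,5)]
    by (auto simp: eqpoll_def)
qed

end
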